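(* Let $n\ge1$, $R=\mathbb{H}[x_1,\dots,x_n]$, and $v\in\mathbb{H}^n$. There exists a left ideal $J\subseteq R$ such that $B(v)=\mathcal{V}(J)$, where $B(v)$ is the enveloping multisphere of $v$.
   Context: $\mathbb{H}$ is Hamilton's algebra of real quaternions. $R=\mathbb{H}[x_1,\dots,x_n]$ is the ring of polynomials in $n$ central variables: the variables commute with each other and with all coefficients. For $f=\sum a_{i_1,\dots,i_n}x_1^{i_1}\cdots x_n^{i_n}\in R$ (coefficients on the left) and any $a=(a_1,\dots,a_n)\in\mathbb{H}^n$, define $f(a)=\sum a_{i_1,\dots,i_n}a_1^{i_1}\cdots a_n^{i_n}$ (products in this order). For $I\subseteq R$, $\mathcal{V}(I)=\{a\in\mathbb{H}^n : f(a)=0 \text{ for all } f\in I\}$. For $m\ge1$, $\mathbb{H}^m_c=\{(q_1,\dots,q_m)\in\mathbb{H}^m : q_iq_j=q_jq_i \text{ for all } i,j\}$. For $w=(q_1,\dots,q_m)\in\mathbb{H}^m$, $\mathbb{S}_w=\{(qq_1q^{-1},\dots,qq_mq^{-1}) : q\in\mathbb{H}\setminus\{0\}\}$. Central presentation: every $v\in\mathbb{H}^n$ can be written uniquely as a concatenation $v=(v_0,\dots,v_r)$ with $r\ge 0$, $v_i=(v_{i,1},\dots,v_{i,k_i})\in\mathbb{H}^{k_i}_c$, $k_i\ge1$, $\sum_{i=0}^r k_i=n$, such that $(v_{i,k_i},v_{i+1})\notin\mathbb{H}^{k_{i+1}+1}_c$ for all $0\le i\le r-1$. The enveloping multisphere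 of $v$ is $B(v)=\{v_0\}\times\mathbb{S}_{v_1}\times\cdots\times\mathbb{S}_{v_r}\subseteq\mathbb{H}^n$. *)

theory Defs
  imports Complex_Main "HOL-Library.Poly_Mapping"
begin

section \<open>Hamilton's quaternions\<close>

datatype quat = Quat (re: real) (im1: real) (im2: real) (im3: real)

instantiation quat :: division_ring
begin

definition "0 = Quat 0 0 0 0"
definition "1 = Quat 1 0 0 0"
definition "p + q = Quat (re p + re q) (im1 p + im1 q) (im2 p + im2 q) (im3 p + im3 q)"
definition "p - q = Quat (re p - re q) (im1 p - im1 q) (im2 p - im2 q) (im3 p - im3 q)"
definition "- q = Quat (- re q) (- im1 q) (- im2 q) (- im3 q)"
definition "p * q = Quat
  (re p * re q - im1 p * im1 q - im2 p * im2 q - im3 p * im3 q)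
  (re p * im1 q + im1 p * re q + im2 p * im3 q - im3 p * im2 q)
  (re p * im2 q - im1 p * im3 q + im2 p * re q + im3 p * im1 q)
  (re p * im3 q + im1 p * im2 q - im2 p * im1 q + im3 p * re q)"
definition "inverse q =
  (let s = (re q)\<^sup>2 + (im1 q)\<^sup>2 + (im2 q)\<^sup>2 + (im3 q)\<^sup>2
   in Quat (re q / s) (- im1 q / s) (- im2 q / s) (- im3 q / s))"
definition "p div q = p * inverse (q :: quat)"

lemmas quat_ring_defs =
  zero_quat_def one_quat_def plus_quat_def minus_quat_def uminus_quat_def times_quat_def

lemma quat_norm_pos:
  assumes "(q :: quat) \<noteq> 0"
  shows "(re q)\<^sup>2 + (im1 q)\<^sup>2 + (im2 q)\<^sup>2 + (im3 q)\<^sup>2 > 0"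
proof -
  have "re q \<noteq> 0 \<or> im1 q \<noteq> 0 \<or> im2 q \<noteq> 0 \<or> im3 q \<noteq> 0"
    using assms by (cases q) (simp add: zero_quat_def)
  then have "(re q)\<^sup>2 > 0 \<or> (im1 q)\<^sup>2 > 0 \<or> (im2 q)\<^sup>2 > 0 \<or> (im3 q)\<^sup>2 > 0"
    by simp
  then show ?thesis
    using zero_le_power2 [of "re q"] zero_le_power2 [of "im1 q"]
      zero_le_power2 [of "im2 q"] zero_le_power2 [of "im3 q"] by linarith
qed

instance
proof
  fix a b c :: quat
  show "a + b + c = a + (b + c)" "a + b = b + a" "0 + a = a" "- a + a = 0" "a - b = a + - b"
    by (simp_all add: quat_ring_defs)
  show "a * b * c = a * (b * c)" "1 * a = a" "a * 1 = a"
    "(a + b) * c = a * c + b * c" "a * (b + c) = a * b + a * c" "(0::quat) \<noteq> 1"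
    by (simp_all add: quat_ring_defs algebra_simps)
  show "inverse (0::quat) = 0"
    by (simp add: inverse_quat_def zero_quat_def)
  show "a div b = a * inverse b"
    by (rule divide_quat_def)
  assume "a \<noteq> 0"
  define s where "s = (re a)\<^sup>2 + (im1 a)\<^sup>2 + (im2 a)\<^sup>2 + (im3 a)\<^sup>2"
  have s: "s \<noteq> 0"
    using quat_norm_pos [OF \<open>a \<noteq> 0\<close>] by (simp add: s_def)
  have inv: "inverse a = Quat (re a / s) (- im1 a / s) (- im2 a / s) (- im3 a / s)"
    by (simp add: inverse_quat_def s_def Let_def)
  have unit: "re a * (re a / s) + im1 a * (im1 a / s) + im2 a * (im2 a / s) + im3 a * (im3 a / s) = 1"
    using s by (simp add: s_def power2_eq_square add_divide_distrib [symmetric])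
  show "inverse a * a = 1" "a * inverse a = 1"
    using unit by (simp_all add: inv times_quat_def one_quat_def mult.commute)
qed

end

section \<open>Polynomials in central variables\<close>

text \<open>
  Points of $H^n$ are lists of length $n$. The type below consists of the finitely supported
  functions from monomials (finitely supported exponent vectors) to coefficients. The product of
  \<^theory>\<open>HOL-Library.Poly_Mapping\<close> is the convolution, in which the coefficients of $f g$
  are sums of products (coefficient of $f$) * (coefficient of $g$); hence the variables are central.
\<close>

type_synonym qpoly = "(nat \<Rightarrow>\<^sub>0 nat) \<Rightarrow>\<^sub>0 quat"

text \<open>The ring $R = H[x_1,\ldots,x_n]$, with $x_{i+1}$ represented by the index $i < n$.\<close>

definition polys :: "nat \<Rightarrow> qpoly set" where
  "polys n = {f. \<forall>m \<in> Poly_Mapping.keys f. Poly_Mapping.keys m \<subseteq> {..<n}}"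

definition eval_poly :: "qpoly \<Rightarrow> quat list \<Rightarrow> quat" where
  "eval_poly f a = (\<Sum>m \<in> Poly_Mapping.keys f.
     Poly_Mapping.lookup f m *
     prod_list (map (\<lambda>i. (a ! i) ^ Poly_Mapping.lookup m i) [0..<length a]))"

definition zero_set :: "nat \<Rightarrow> qpoly set \<Rightarrow> quat list set" where
  "zero_set n I = {a. length a = n \<and> (\<forall>f \<in> I. eval_poly f a = 0)}"

definition left_ideal :: "nat \<Rightarrow> qpoly set \<Rightarrow> bool" where
  "left_ideal n J \<longleftrightarrow>
     J \<subseteq> polys n \<and> 0 \<in> J \<and> (\<forall>f \<in> J. \<forall>g \<in> J. f + g \<in> J) \<and> (\<forall>f \<in> J. - f \<in> J) \<and>
     (\<forall>f \<in> polys n. \<forall>g \<in> J. f * g \<in> J)"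

section \<open>The enveloping multisphere\<close>

definition commuting :: "quat list \<Rightarrow> bool" where
  "commuting w \<longleftrightarrow> (\<forall>p \<in> set w. \<forall>q \<in> set w. p * q = q * p)"

definition sphere :: "quat list \<Rightarrow> quat list set" where
  "sphere w = {map (\<lambda>p. q * p * inverse q) w | q. q \<noteq> 0}"

definition central_presentation :: "quat list \<Rightarrow> quat list list \<Rightarrow> bool" where
  "central_presentation v vs \<longleftrightarrow>
     vs \<noteq> [] \<and> concat vs = v \<and> (\<forall>w \<in> set vs. w \<noteq> [] \<and> commuting w) \<and>
     (\<forall>i. Suc i < length vs \<longrightarrow> \<not> commuting (last (vs ! i) # vs ! Suc i))"

definition central_blocks :: "quat list \<Rightarrow> quat list list" where
  "central_blocks v = (THE vs. central_presentation v vs)"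

definition multisphere :: "quat list \<Rightarrow> quat list set" where
  "multisphere v = {hd (central_blocks v) @ concat ws | ws.
     list_all2 (\<lambda>w u. w \<in> sphere u) ws (tl (central_blocks v))}"

text \<open>Every nonempty list has exactly one central presentation, so the description in
  \<^const>\<open>central_blocks\<close> is proper.\<close>

lemma central_presentation_single:
  "central_presentation v [w] \<longleftrightarrow> w = v \<and> v \<noteq> [] \<and> commuting v"
  by (auto simp: central_presentation_def)

lemma central_presentation_Cons:
  assumes "us \<noteq> []"
  shows "central_presentation v (w # us) \<longleftrightarrow>
    (\<exists>v'. v = w @ v' \<and> w \<noteq> [] \<and> commuting w \<and> \<not> commuting (last w # hd us) \<and>
      central_presentation v' us)"
proof -
  have "(\<forall>i. Suc i < length (w # us) \<longrightarrow> \<not> commuting (last ((w # us) ! i) # (w # us) ! Suc i)) \<longleftrightarrow>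
      \<not> commuting (last w # hd us) \<and>
      (\<forall>i. Suc i < length us \<longrightarrow> \<not> commuting (last (us ! i) # us ! Suc i))" (is "?l \<longleftrightarrow> ?r")
  proof
    assume l: ?l
    have "\<not> commuting (last (us ! i) # us ! Suc i)" if "Suc i < length us" for i
      using l [rule_format, of "Suc i"] that by simp
    then show ?r
      using l [rule_format, of 0] assms by (simp add: hd_conv_nth)
  next
    assume r: ?r
    show ?l
    proof (intro allI impI)
      fix i assume "Suc i < length (w # us)"
      then show "\<not> commuting (last ((w # us) ! i) # (w # us) ! Suc i)"
        using r assms by (cases i) (auto simp: hd_conv_nth)
    qed
  qed
  note conds = this
  show ?thesis
    unfolding central_presentation_def conds using assms by (simp add: conj_ac) blast
qed

lemma central_presentation_extend:
  "central_presentation v ((x # y # w) # us) \<Longrightarrow>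
    v = x # tl v \<and> commuting (x # y # w) \<and> central_presentation (tl v) ((y # w) # us)"
proof -
  assume pres: "central_presentation v ((x # y # w) # us)"
  have sub: "commuting (y # w)" if "commuting (x # y # w)"
    using that unfolding commuting_def by (meson list.set_intros(2))
  show ?thesis
  proof (cases "us = []")
    case True
    with pres sub show ?thesis
      by (auto simp: central_presentation_single)
  next
    case False
    with pres obtain v' where v': "v = (x # y # w) @ v'" "commuting (x # y # w)"
        "\<not> commuting (last (x # y # w) # hd us)" "central_presentation v' us"
      using central_presentation_Cons by blast
    have "last (x # y # w) = last (y # w)"
      by simp
    then have "central_presentation ((y # w) @ v') ((y # w) # us)"
      using False sub v'
      by (metis central_presentation_Cons list.distinct(1))
    with v' show ?thesis by simp
  qed
qed

lemma central_presentation_hd: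
  "central_presentation v vs \<Longrightarrow> vs \<noteq> [] \<and> hd vs \<noteq> [] \<and> concat vs = v"
  unfolding central_presentation_def using hd_in_set [of vs] by blast

lemma central_presentation_ex1:
  assumes "v \<noteq> []"
  shows "\<exists>!vs. central_presentation v vs"
  using assms
proof (induction v)
  case Nil
  then show ?case by simp
next
  case (Cons x v)
  show ?case
  proof (cases "v = []")
    case True
    have "central_presentation [x] [[x]]"
      by (simp add: central_presentation_single commuting_def)
    moreover have "vs = [[x]]" if pres: "central_presentation [x] vs" for vs
    proof -
      obtain w ws where vs: "vs = w # ws" and w: "w \<noteq> []" and eq: "w @ concat ws = [x]"
        using central_presentation_hd [OF pres] by (cases vs) auto
      have "w = [x]" and "concat ws = []"
        using w eq by (cases w; simp)+
      moreover from this have "ws = []"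
        using pres vs by (cases ws) (auto simp: central_presentation_def)
      ultimately show ?thesis
        using vs by simp
    qed
    ultimately show ?thesis
      using True by blast
  next
    case False
    then obtain us where us: "central_presentation v us"
      and uniq: "\<And>vs. central_presentation v vs \<Longrightarrow> vs = us"
      using Cons.IH by blast
    obtain y w ws where us_eq: "us = (y # w) # ws"
      using central_presentation_hd [OF us] by (metis list.exhaust_sel)
    have shape: "(commuting (x # y # w) \<and> vs = (x # y # w) # ws) \<or>
        (\<not> commuting (x # y # w) \<and> vs = [x] # (y # w) # ws)"
      if vs: "central_presentation (x # v) vs" for vs
    proof -
      have "vs \<noteq> [] \<and> hd vs \<noteq> [] \<and> concat vs = x # v"
        using central_presentation_hd [OF vs] .
      then obtain b bs where vs_eq: "vs = (x # b) # bs"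
        by (cases vs; cases "hd vs") auto
      show ?thesis
      proof (cases b)
        case Nil
        have "bs \<noteq> []"
          using vs vs_eq Nil False by (auto simp: central_presentation_single)
        then have "central_presentation v bs" "\<not> commuting (x # hd bs)"
          using vs vs_eq Nil by (auto simp: central_presentation_Cons)
        with uniq [of bs] show ?thesis
          using vs_eq Nil us_eq by simp
      next
        case (Cons y' b')
        then have "commuting (x # y' # b')" "central_presentation v ((y' # b') # bs)"
          using central_presentation_extend [of "x # v" x y' b' bs] vs vs_eq by auto
        with uniq [of "(y' # b') # bs"] show ?thesis
          using vs_eq Cons us_eq by simp
      qed
    qed
    have "\<exists>vs. central_presentation (x # v) vs"
    proof (cases "commuting (x # y # w)")
      case True
      have "central_presentation (x # v) ((x # y # w) # ws)"
        using us us_eq True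
        by (cases "ws = []") (auto simp: central_presentation_single central_presentation_Cons)
      then show ?thesis ..
    next
      case False
      have "central_presentation (x # v) ([x] # us)"
        using us us_eq False
        by (subst central_presentation_Cons) (auto simp: commuting_def)
      then show ?thesis ..
    qed
    then show ?thesis
      using shape by blast
  qed
qed

lemma central_presentation_central_blocks:
  "v \<noteq> [] \<Longrightarrow> central_presentation v (central_blocks v)"
  unfolding central_blocks_def using theI' [OF central_presentation_ex1] .

end

theory Submission
  imports Defs
begin

text \<open>
  The ideal $J$ is the largest left ideal of $R$ that vanishes on $B(v)$: it consists of the $f$
  such that $g f$ vanishes on $B(v)$ for all $g$ (lemma \<open>left_ideal_vanishing_left_ideal\<close>).
  Taking $g = 1$ gives $B(v) \<subseteq> V(J)$, so the point is to find enough elements of $J$ to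
  confine a common zero to $B(v)$. That a polynomial $f$ vanishes on $B(v)$ does not suffice: in
  $(x^m f)(b)$ the powers of the coordinates of $b$ are inserted in the middle of the terms of
  $f(b)$, and the coordinates do not commute.

  Lemma \<open>eval_poly_mult_eq_0\<close> describes when the insertion is harmless: $f$ involves only the
  variables of one block, in which the coordinates of $b$ commute, and the coefficients of $f$
  commute with all coordinates of $b$ up to the end of this block. Then $(x^m f)(b)$ is
  $f(b)$ with one factor on each side. Two kinds of polynomials meet this condition on all of
  $B(v)$. For the first block, which is the same in all points of $B(v)$, these are the
  $x_j - v_j$; they force the first block of a common zero to be $v_0$. For every block, these are
  the real polynomials in its variables; such a polynomial vanishes on $S_{v_i}$ as soon as it
  vanishes at $v_i$, since conjugation respects real relations.

  Finally, real relations cut out $S_w$ for a commuting tuple $w$ (lemma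
  \<open>in_sphere_if_relations\<close>). The entries of $w$ lie in one copy of the complex numbers, so
  some entry $w_j$ expresses each of them as a real affine function $w_i = \<beta> w_j + \<alpha>$. A tuple
  that satisfies these relations is determined by its entry with index $j$, and the quadratic
  equation of $w_j$ over the reals forces this entry to be conjugate to $w_j$. Hence the whole tuple
  is conjugate to $w$. All the relations used have the form $x_i^e = b x_j + c$.
\<close>

section \<open>Conjugacy of commuting tuples of quaternions\<close>

definition real_quat :: "real \<Rightarrow> quat" where
  "real_quat x = Quat x 0 0 0"

lemma real_quat_central: "real_quat x * q = q * real_quat x"
  by (simp add: real_quat_def times_quat_def algebra_simps)

lemma real_quat_0: "real_quat 0 = 0"
  by (simp add: real_quat_def zero_quat_def)

lemma quat_quadratic:
  "p\<^sup>2 = real_quat (2 * re p) * p + real_quat (- ((re p)\<^sup>2 + (im1 p)\<^sup>2 + (im2 p)\<^sup>2 + (im3 p)\<^sup>2))"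
  by (simp add: real_quat_def times_quat_def plus_quat_def power2_eq_square algebra_simps)

text \<open>
  For imaginary quaternions $u, u'$ of equal norm, $u^2 = u'^2$ is a real number, and so
  $u' (u' z + z u) = (u' z + z u) u$ for every $z$. Thus every nonzero $u' z + z u$ intertwines.
\<close>

lemma quat_intertwiner:
  assumes "re p = re p'"
    and "(im1 p)\<^sup>2 + (im2 p)\<^sup>2 + (im3 p)\<^sup>2 = (im1 p')\<^sup>2 + (im2 p')\<^sup>2 + (im3 p')\<^sup>2"
  shows "\<exists>q. q \<noteq> 0 \<and> p' * q = q * p"
proof -
  define u u' where "u = Quat 0 (im1 p) (im2 p) (im3 p)" and "u' = Quat 0 (im1 p') (im2 p') (im3 p')"
  have p: "p = real_quat (re p) + u" "p' = real_quat (re p) + u'"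
    using assms(1) by (cases p; cases p'; simp add: u_def u'_def real_quat_def plus_quat_def)+
  define N where "N = real_quat (- ((im1 p)\<^sup>2 + (im2 p)\<^sup>2 + (im3 p)\<^sup>2))"
  have uu: "u * u = N" "u' * u' = N"
    using assms(2)
    by (simp_all add: u_def u'_def N_def times_quat_def real_quat_def power2_eq_square)
  have twine: "p' * (u' * z + z * u) = (u' * z + z * u) * p" for z
  proof -
    have "u' * (u' * z + z * u) = (u' * z + z * u) * u"
      using real_quat_central [of _ z]
      by (simp add: distrib_left distrib_right mult.assoc uu N_def flip: mult.assoc [of u' u'])
    moreover have "p' * (u' * z + z * u) =
        real_quat (re p) * (u' * z + z * u) + u' * (u' * z + z * u)"
      by (subst p(2)) (rule distrib_right)
    ultimately show ?thesis
      using p(1) by (metis distrib_left real_quat_central)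
  qed
  show ?thesis
  proof (cases "\<exists>z. u' * z + z * u \<noteq> 0")
    case True
    then show ?thesis using twine by blast
  next
    case False
    then have z: "u' * z + z * u = 0" for z by blast
    \<comment> \<open>The case \<open>z = 1\<close> says that \<open>u' = - u\<close>; then the two imaginary units say that
      \<open>u\<close> commutes with them, so \<open>u\<close> is real and imaginary, hence 0.\<close>
    have "p' = p"
      using z [of 1] z [of "Quat 0 1 0 0"] z [of "Quat 0 0 1 0"] assms(1)
      by (cases p; cases p'; simp add: u_def u'_def times_quat_def plus_quat_def zero_quat_def)
    then show ?thesis
      by (intro exI [of _ 1]) simp
  qed
qed

text \<open>
  With $\<alpha>$ the real part and $N$ the squared norm of the imaginary part of $p$, the equation reads
  $(p' - \<alpha>)^2 = - N$. If $p' - \<alpha>$ had a nonzero real part, it would be real, with a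
  positive square. So $p'$ has the same real part as $p$, and its imaginary part has the same norm.
\<close>

lemma quat_conjugate_of_quadratic:
  assumes "p'\<^sup>2 = real_quat (2 * re p) * p' +
    real_quat (- ((re p)\<^sup>2 + (im1 p)\<^sup>2 + (im2 p)\<^sup>2 + (im3 p)\<^sup>2))"
  shows "\<exists>q. q \<noteq> 0 \<and> p' = q * p * inverse q"
proof -
  define x y1 y2 y3 where p': "x = re p'" "y1 = im1 p'" "y2 = im2 p'" "y3 = im3 p'"
  define \<alpha> N where "\<alpha> = re p" and N: "N = (im1 p)\<^sup>2 + (im2 p)\<^sup>2 + (im3 p)\<^sup>2"
  have eqs: "x * x - y1 * y1 - y2 * y2 - y3 * y3 = 2 * \<alpha> * x - (\<alpha>\<^sup>2 + N)"
    "(x - \<alpha>) * y1 = 0" "(x - \<alpha>) * y2 = 0" "(x - \<alpha>) * y3 = 0"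
    using assms
    by (simp_all add: p' \<alpha>_def N real_quat_def times_quat_def plus_quat_def power2_eq_square
        algebra_simps)
  have "N \<ge> 0" by (simp add: N)
  have x: "x = \<alpha>"
  proof (rule ccontr)
    assume "x \<noteq> \<alpha>"
    then have "(x - \<alpha>)\<^sup>2 + N = 0"
      using eqs by (simp add: power2_eq_square algebra_simps)
    with \<open>N \<ge> 0\<close> \<open>x \<noteq> \<alpha>\<close> show False
      by (smt (verit) zero_less_power2)
  qed
  have "re p = re p'"
    "(im1 p)\<^sup>2 + (im2 p)\<^sup>2 + (im3 p)\<^sup>2 = (im1 p')\<^sup>2 + (im2 p')\<^sup>2 + (im3 p')\<^sup>2"
    using eqs(1) x unfolding N \<alpha>_def p' by (simp_all add: power2_eq_square)
  then obtain q where "q \<noteq> 0" "p' * q = q * p"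
    using quat_intertwiner by blast
  then show ?thesis
    by (metis mult.assoc mult.right_neutral right_inverse)
qed

text \<open>
  The imaginary part of $p q - q p$ is twice the cross product of the imaginary parts of $p$ and
  $q$, so these are parallel.
\<close>

lemma commuting_nonreal_affine:
  assumes "p * q = q * p" and "p \<noteq> real_quat (re p)"
  shows "\<exists>\<beta> \<alpha>. q = real_quat \<beta> * p + real_quat \<alpha>"
proof -
  obtain a1 a2 a3 a0 where p: "p = Quat a0 a1 a2 a3" by (cases p)
  obtain b1 b2 b3 b0 where q: "q = Quat b0 b1 b2 b3" by (cases q)
  have par: "a1 * b2 = a2 * b1" "a2 * b3 = a3 * b2" "a1 * b3 = a3 * b1"
    using assms(1) by (simp_all add: p q times_quat_def algebra_simps)
  have nz: "a1 \<noteq> 0 \<or> a2 \<noteq> 0 \<or> a3 \<noteq> 0"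
    using assms(2) by (auto simp: p real_quat_def)
  have "\<exists>\<beta>. b1 = \<beta> * a1 \<and> b2 = \<beta> * a2 \<and> b3 = \<beta> * a3"
  proof -
    consider "a1 \<noteq> 0" | "a2 \<noteq> 0" | "a3 \<noteq> 0" using nz by blast
    then show ?thesis
    proof cases
      case 1
      then show ?thesis using par by (intro exI [of _ "b1 / a1"]) (simp add: field_simps)
    next
      case 2
      then show ?thesis using par by (intro exI [of _ "b2 / a2"]) (simp add: field_simps)
    next
      case 3
      then show ?thesis using par by (intro exI [of _ "b3 / a3"]) (simp add: field_simps)
    qed
  qed
  then obtain \<beta> where "b1 = \<beta> * a1" "b2 = \<beta> * a2" "b3 = \<beta> * a3" by blast
  then have "q = real_quat \<beta> * p + real_quat (b0 - \<beta> * a0)"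
    by (simp add: p q real_quat_def times_quat_def plus_quat_def)
  then show ?thesis by blast
qed

lemma commuting_affine:
  assumes "commuting w" and "w \<noteq> []"
  shows "\<exists>p \<in> set w. \<forall>q \<in> set w. \<exists>\<beta> \<alpha>. q = real_quat \<beta> * p + real_quat \<alpha>"
proof (cases "\<exists>p \<in> set w. p \<noteq> real_quat (re p)")
  case True
  then show ?thesis
    using assms commuting_nonreal_affine unfolding commuting_def by metis
next
  case False
  then have "q = real_quat 0 * hd w + real_quat (re q)" if "q \<in> set w" for q
    using that by (simp add: real_quat_0)
  then show ?thesis
    using assms(2) hd_in_set by blast
qed

lemma conj_power: "q \<noteq> 0 \<Longrightarrow> (q * p * inverse q) ^ e = q * p ^ e * inverse (q :: quat)"
proof (induction e)
  case (Suc e)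
  have "q * p * inverse q * (q * p ^ e * inverse q) = q * p * (inverse q * q) * p ^ e * inverse q"
    by (simp only: mult.assoc)
  with Suc show ?case by (simp add: mult.assoc)
qed simp

lemma conj_affine:
  assumes "q \<noteq> 0"
  shows "q * (real_quat \<beta> * p + real_quat \<alpha>) * inverse q =
    real_quat \<beta> * (q * p * inverse q) + real_quat \<alpha>"
proof -
  have "q * (real_quat \<beta> * p + real_quat \<alpha>) * inverse q =
      (q * real_quat \<beta>) * p * inverse q + (q * real_quat \<alpha>) * inverse q"
    by (simp only: distrib_left distrib_right mult.assoc)
  also have "\<dots> = real_quat \<beta> * (q * p * inverse q) + real_quat \<alpha> * (q * inverse q)"
    by (simp only: real_quat_central [of _ q, symmetric] mult.assoc)
  finally show ?thesis
    using assms by simp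
qed

text \<open>
  Conjugation is a ring automorphism that fixes the real numbers, so it preserves real relations.
\<close>

lemma sphere_relation:
  assumes "w \<in> sphere u" and "i < length u" "j < length u"
    and "u ! i ^ e = real_quat b * u ! j + real_quat c"
  shows "w ! i ^ e = real_quat b * w ! j + real_quat c"
proof -
  obtain q where q: "q \<noteq> 0" and w: "w = map (\<lambda>p. q * p * inverse q) u"
    using assms(1) by (auto simp: sphere_def)
  have "w ! i ^ e = q * (real_quat b * u ! j + real_quat c) * inverse q"
    using assms q by (simp add: w conj_power)
  then show ?thesis
    using assms q by (simp add: w conj_affine)
qed

lemma sphere_length: "w \<in> sphere u \<Longrightarrow> length w = length u"
  by (auto simp: sphere_def)

lemma sphere_self: "u \<in> sphere u"
  unfolding sphere_def by (intro CollectI exI [of _ 1]) simp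

lemma sphere_commuting:
  assumes "w \<in> sphere u" "commuting u"
  shows "commuting w"
proof -
  obtain q where q: "q \<noteq> 0" and w: "w = map (\<lambda>p. q * p * inverse q) u"
    using assms(1) by (auto simp: sphere_def)
  have "(q * x * inverse q) * (q * y * inverse q) = q * (x * y) * inverse q" for x y
  proof -
    have "(q * x * inverse q) * (q * y * inverse q) = q * x * (inverse q * q) * y * inverse q"
      by (simp only: mult.assoc)
    with q show ?thesis by (simp add: mult.assoc)
  qed
  with assms(2) show ?thesis
    by (simp add: commuting_def w)
qed

text \<open>
  One entry of \<^term>\<open>u\<close> expresses all others by real affine relations, and its own quadratic
  equation pins down its conjugacy class; the element that conjugates this entry then conjugates
  all of them.
\<close>

lemma in_sphere_if_relations:
  assumes "commuting u" "u \<noteq> []" "length w = length u"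
    and rel: "\<And>e i j b c. i < length u \<Longrightarrow> j < length u \<Longrightarrow>
      u ! i ^ e = real_quat b * u ! j + real_quat c \<Longrightarrow>
      w ! i ^ e = real_quat b * w ! j + real_quat c"
  shows "w \<in> sphere u"
proof -
  obtain j where j: "j < length u"
    and aff: "\<And>i. i < length u \<Longrightarrow> \<exists>\<beta> \<alpha>. u ! i = real_quat \<beta> * u ! j + real_quat \<alpha>"
    using commuting_affine [OF assms(1,2)] by (metis in_set_conv_nth nth_mem)
  obtain q where q: "q \<noteq> 0" "w ! j = q * u ! j * inverse q"
    using quat_conjugate_of_quadratic [OF rel [OF j j quat_quadratic]] by blast
  have "w ! i = q * u ! i * inverse q" if i: "i < length u" for i
  proof -
    obtain \<beta> \<alpha> where u: "u ! i = real_quat \<beta> * u ! j + real_quat \<alpha>"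
      using aff [OF i] by blast
    then have "w ! i = real_quat \<beta> * (q * u ! j * inverse q) + real_quat \<alpha>"
      using rel [OF i j, of 1] q by simp
    then show ?thesis
      using u q conj_affine by simp
  qed
  then have "w = map (\<lambda>p. q * p * inverse q) u"
    using assms(3) by (intro nth_equalityI) simp_all
  with q show ?thesis
    unfolding sphere_def by blast
qed

section \<open>Evaluation at a point\<close>

text \<open>
  The index list is a parameter because a monomial is cut below at the end of a block.
\<close>

definition monom_prod :: "quat list \<Rightarrow> (nat \<Rightarrow>\<^sub>0 nat) \<Rightarrow> nat list \<Rightarrow> quat" where
  "monom_prod a m is = prod_list (map (\<lambda>i. a ! i ^ Poly_Mapping.lookup m i) is)"

lemma eval_poly_monom_prod:
  "eval_poly f a = (\<Sum>m \<in> Poly_Mapping.keys f.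
    Poly_Mapping.lookup f m * monom_prod a m [0..<length a])"
  by (simp add: eval_poly_def monom_prod_def)

lemma monom_prod_append: "monom_prod a m (is @ js) = monom_prod a m is * monom_prod a m js"
  by (simp add: monom_prod_def)

lemma monom_prod_trivial:
  "(\<And>i. i \<in> set is \<Longrightarrow> Poly_Mapping.lookup m i = 0) \<Longrightarrow> monom_prod a m is = 1"
  unfolding monom_prod_def by (induction "is") auto

lemma commutes_prod_list:
  "(\<And>x. x \<in> set xs \<Longrightarrow> y * x = x * y) \<Longrightarrow> y * prod_list xs = prod_list xs * (y :: 'a :: monoid_mult)"
  by (induction xs) (simp, metis list.set_intros mult.assoc prod_list.Cons)

lemma commutes_power: "y * x = x * y \<Longrightarrow> y * x ^ k = x ^ k * (y :: 'a :: monoid_mult)"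
  by (metis power_commuting_commutes)

lemma commutes_monom_prod:
  assumes "\<And>i. i \<in> set is \<Longrightarrow> Poly_Mapping.lookup m i \<noteq> 0 \<Longrightarrow> y * a ! i = a ! i * y"
  shows "y * monom_prod a m is = monom_prod a m is * y"
  unfolding monom_prod_def
proof (rule commutes_prod_list)
  fix x assume "x \<in> set (map (\<lambda>i. a ! i ^ Poly_Mapping.lookup m i) is)"
  then obtain i where "i \<in> set is" "x = a ! i ^ Poly_Mapping.lookup m i" by auto
  with assms [of i] show "y * x = x * y"
    by (cases "Poly_Mapping.lookup m i = 0") (simp_all add: commutes_power)
qed

text \<open>
  Although evaluation is not multiplicative, the powers belonging to \<^term>\<open>k\<close> can be
  collected on the right: they start at \<^term>\<open>l\<close>, and from there on they have to pass only
  commuting coordinates.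
\<close>

lemma monom_prod_add:
  assumes "Poly_Mapping.keys k \<subseteq> {l..}"
    and "\<And>i j. \<lbrakk>l \<le> i; i < r; l \<le> j; j < r\<rbrakk> \<Longrightarrow> a ! i * a ! j = a ! j * a ! i"
  shows "monom_prod a (m + k) [0..<r] = monom_prod a m [0..<r] * monom_prod a k [0..<r]"
  using assms(2)
proof (induction r)
  case 0
  then show ?case by (simp add: monom_prod_def)
next
  case (Suc r)
  have "a ! r ^ Poly_Mapping.lookup m r * monom_prod a k [0..<r] =
      monom_prod a k [0..<r] * a ! r ^ Poly_Mapping.lookup m r"
  proof (rule commutes_monom_prod)
    fix i assume i: "i \<in> set [0..<r]" "Poly_Mapping.lookup k i \<noteq> 0"
    then have "i \<in> Poly_Mapping.keys k"
      by (simp add: in_keys_iff)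
    with assms(1) i have "l \<le> i" "i < r"
      by auto
    with Suc.prems [of i r] show "a ! r ^ Poly_Mapping.lookup m r * a ! i =
        a ! i * a ! r ^ Poly_Mapping.lookup m r"
      using commutes_power [of "a ! i" "a ! r"] by simp
  qed
  note swap = this
  have "monom_prod a (m + k) [0..<Suc r] =
      monom_prod a m [0..<r] * (monom_prod a k [0..<r] * a ! r ^ Poly_Mapping.lookup m r) *
        a ! r ^ Poly_Mapping.lookup k r"
    using Suc by (simp add: monom_prod_append mult.assoc)
      (simp add: monom_prod_def lookup_add power_add)
  also have "\<dots> = monom_prod a m [0..<Suc r] * monom_prod a k [0..<Suc r]"
    unfolding swap [symmetric]
    by (simp add: monom_prod_append mult.assoc) (simp add: monom_prod_def)
  finally show ?case .
qed

lemma eval_poly_0: "eval_poly 0 a = 0"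
  by (simp add: eval_poly_def)

lemma eval_poly_single: "eval_poly (Poly_Mapping.single m c) a = c * monom_prod a m [0..<length a]"
  by (cases "c = 0") (simp_all add: eval_poly_monom_prod)

lemma eval_poly_add: "eval_poly (f + g) a = eval_poly f a + eval_poly g a"
  unfolding eval_poly_monom_prod
  by (rule setsum_keys_plus_distrib) (simp_all add: distrib_right)

lemma eval_poly_uminus: "eval_poly (- f) a = - eval_poly f a"
  using eval_poly_add [of "- f" f a] by (simp add: eval_poly_0 eq_neg_iff_add_eq_0)

lemma eval_poly_diff: "eval_poly (f - g) a = eval_poly f a - eval_poly g a"
  using eval_poly_add [of f "- g" a] by (simp add: eval_poly_uminus)

lemma eval_poly_sum: "eval_poly (sum f A) a = (\<Sum>x \<in> A. eval_poly (f x) a)"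
  by (induction A rule: infinite_finite_induct) (simp_all add: eval_poly_0 eval_poly_add)

lemma sum_singles: "f = (\<Sum>m \<in> Poly_Mapping.keys f. Poly_Mapping.single m (Poly_Mapping.lookup f m))"
  by (rule poly_mapping_eqI)
    (simp add: lookup_sum lookup_single when_def in_keys_iff)

lemma eval_poly_mult:
  "eval_poly (g * f) a = (\<Sum>m \<in> Poly_Mapping.keys g. \<Sum>k \<in> Poly_Mapping.keys f.
    Poly_Mapping.lookup g m * Poly_Mapping.lookup f k * monom_prod a (m + k) [0..<length a])"
proof -
  have "g * f = (\<Sum>m \<in> Poly_Mapping.keys g. Poly_Mapping.single m (Poly_Mapping.lookup g m)) *
      (\<Sum>k \<in> Poly_Mapping.keys f. Poly_Mapping.single k (Poly_Mapping.lookup f k))"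
    using sum_singles [of f] sum_singles [of g] by simp
  also have "\<dots> = (\<Sum>m \<in> Poly_Mapping.keys g. \<Sum>k \<in> Poly_Mapping.keys f.
      Poly_Mapping.single (m + k) (Poly_Mapping.lookup g m * Poly_Mapping.lookup f k))"
    by (simp add: sum_product mult_single)
  finally show ?thesis
    by (simp add: eval_poly_sum eval_poly_single)
qed

text \<open>
  For a monomial $x^m$ write its value at $a$ as $H_m T_m$, cut at index $r$. Each term of $f$ has
  the value $f_k H_k$, and $f_k H_{m+k} T_m = f_k H_m H_k T_m = H_m (f_k H_k) T_m$. Summing over
  $k$ shows that $(c x^m f)(a) = c H_m f(a) T_m$.
\<close>

lemma eval_poly_mult_eq_0:
  assumes "r \<le> length a"
    and vars: "\<And>k. k \<in> Poly_Mapping.keys f \<Longrightarrow> Poly_Mapping.keys k \<subseteq> {l..<r}"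
    and block: "\<And>i j. \<lbrakk>l \<le> i; i < r; l \<le> j; j < r\<rbrakk> \<Longrightarrow> a ! i * a ! j = a ! j * a ! i"
    and coeffs: "\<And>k i. i < r \<Longrightarrow> Poly_Mapping.lookup f k * a ! i = a ! i * Poly_Mapping.lookup f k"
    and root: "eval_poly f a = 0"
  shows "eval_poly (g * f) a = 0"
proof -
  define H where "H m = monom_prod a m [0..<r]" for m
  define T where "T m = monom_prod a m [r..<length a]" for m
  have split: "monom_prod a m [0..<length a] = H m * T m" for m
    unfolding H_def T_def using assms(1)
    by (metis le_add_diff_inverse monom_prod_append upt_add_eq_append zero_le)
  have "(\<Sum>k \<in> Poly_Mapping.keys f.
        Poly_Mapping.lookup g m * Poly_Mapping.lookup f k * monom_prod a (m + k) [0..<length a]) =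
      Poly_Mapping.lookup g m * H m * eval_poly f a * T m" for m
  proof -
    have "Poly_Mapping.lookup g m * Poly_Mapping.lookup f k * monom_prod a (m + k) [0..<length a] =
        Poly_Mapping.lookup g m * H m * (Poly_Mapping.lookup f k * monom_prod a k [0..<length a]) * T m"
      if k: "k \<in> Poly_Mapping.keys f" for k
    proof -
      have zero: "Poly_Mapping.lookup k i = 0" if "r \<le> i" for i
        using vars [OF k] that by (auto simp: in_keys_iff subset_iff)
      have "H (m + k) = H m * H k"
        unfolding H_def by (rule monom_prod_add [of k l]) (use vars [OF k] block in auto)
      moreover have "T (m + k) = T m"
        unfolding T_def monom_prod_def
        by (intro arg_cong [where f = prod_list] map_cong) (auto simp: lookup_add zero)
      moreover have "T k = 1"
        unfolding T_def by (rule monom_prod_trivial) (auto simp: zero)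
      moreover have "Poly_Mapping.lookup f k * H m = H m * Poly_Mapping.lookup f k"
        unfolding H_def by (rule commutes_monom_prod) (auto simp: coeffs)
      ultimately show ?thesis
        unfolding split by (simp add: mult.assoc) (metis mult.assoc)
    qed
    then have "(\<Sum>k \<in> Poly_Mapping.keys f.
        Poly_Mapping.lookup g m * Poly_Mapping.lookup f k * monom_prod a (m + k) [0..<length a]) =
        (\<Sum>k \<in> Poly_Mapping.keys f.
          Poly_Mapping.lookup g m * H m * (Poly_Mapping.lookup f k * monom_prod a k [0..<length a]) * T m)"
      by (rule sum.cong [OF refl])
    then show ?thesis
      by (simp add: eval_poly_monom_prod sum_distrib_left sum_distrib_right)
  qed
  then show ?thesis
    by (simp add: eval_poly_mult root)
qed

text \<open>
  The affine relations ($e = 1$), the quadratic equation of one coordinate ($e = 2$, $i = j$) and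
  the equations $x_j = v_j$ of the first block all have the form $x_i^e = b x_j + c$.
\<close>

definition relation_poly :: "nat \<Rightarrow> nat \<Rightarrow> nat \<Rightarrow> quat \<Rightarrow> quat \<Rightarrow> qpoly" where
  "relation_poly i e j b c = Poly_Mapping.single (Poly_Mapping.single i e) 1
    - Poly_Mapping.single (Poly_Mapping.single j 1) b - Poly_Mapping.single 0 c"

lemma monom_prod_single:
  assumes "i < n"
  shows "monom_prod a (Poly_Mapping.single i e) [0..<n] = a ! i ^ e"
proof -
  have "[0..<n] = [0..<i] @ i # [Suc i..<n]"
    using assms by (metis le_add_diff_inverse less_imp_le_nat upt_add_eq_append upt_conv_Cons zero_le)
  moreover have "monom_prod a (Poly_Mapping.single i e) [0..<i] = 1"
    "monom_prod a (Poly_Mapping.single i e) [Suc i..<n] = 1"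
    by (rule monom_prod_trivial; auto simp: lookup_single when_def)+
  ultimately show ?thesis
    by (simp add: monom_prod_append) (simp add: monom_prod_def)
qed

lemma eval_relation_poly:
  "i < length a \<Longrightarrow> j < length a \<Longrightarrow>
    eval_poly (relation_poly i e j b c) a = a ! i ^ e - b * a ! j - c"
  by (simp add: relation_poly_def eval_poly_diff eval_poly_single monom_prod_single
      monom_prod_trivial)

lemma keys_relation_poly:
  "k \<in> Poly_Mapping.keys (relation_poly i e j b c) \<Longrightarrow> Poly_Mapping.keys k \<subseteq> {i, j}"
  by (auto simp: relation_poly_def in_keys_iff lookup_minus lookup_single when_def split: if_splits)

lemma lookup_relation_poly_commutes:
  assumes "b * q = q * b" "c * q = q * c"
  shows "Poly_Mapping.lookup (relation_poly i e j b c) k * q =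
    q * Poly_Mapping.lookup (relation_poly i e j b c) k"
  unfolding relation_poly_def lookup_minus lookup_single when_def
  using assms by (simp add: left_diff_distrib right_diff_distrib)

section \<open>The largest left ideal vanishing on a set\<close>

text \<open>
  Requiring all left multiples to vanish makes this a left ideal, which the set of polynomials that
  vanish on \<^term>\<open>B\<close> is not in general.
\<close>

definition vanishing_left_ideal :: "nat \<Rightarrow> quat list set \<Rightarrow> qpoly set" where
  "vanishing_left_ideal n B =
    {f \<in> polys n. \<forall>g \<in> polys n. \<forall>b \<in> B. eval_poly (g * f) b = 0}"

lemma polys_add: "f \<in> polys n \<Longrightarrow> g \<in> polys n \<Longrightarrow> f + g \<in> polys n"
  using keys_add [of f g] by (auto simp: polys_def)

lemma polys_uminus: "f \<in> polys n \<Longrightarrow> - f \<in> polys n"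
  by (auto simp: polys_def in_keys_iff)

lemma polys_mult: "f \<in> polys n \<Longrightarrow> g \<in> polys n \<Longrightarrow> f * g \<in> polys n"
proof -
  assume fg: "f \<in> polys n" "g \<in> polys n"
  have "Poly_Mapping.keys m \<subseteq> {..<n}" if m: "m \<in> Poly_Mapping.keys (f * g)" for m
  proof -
    obtain k l where "m = k + l" "k \<in> Poly_Mapping.keys f" "l \<in> Poly_Mapping.keys g"
      using keys_mult [of f g] m by blast
    with fg keys_add [of k l] show ?thesis
      unfolding polys_def by blast
  qed
  then show ?thesis
    by (simp add: polys_def)
qed

lemma polys_0_1: "0 \<in> polys n" "1 \<in> polys n"
  by (simp_all add: polys_def)

lemma left_ideal_vanishing_left_ideal: "left_ideal n (vanishing_left_ideal n B)"
  unfolding left_ideal_def vanishing_left_ideal_def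
  by (auto simp: polys_add polys_uminus polys_mult polys_0_1 eval_poly_0 eval_poly_add
      eval_poly_uminus distrib_left mult.assoc [symmetric])

lemma subset_zero_set_vanishing_left_ideal:
  assumes "\<And>b. b \<in> B \<Longrightarrow> length b = n"
  shows "B \<subseteq> zero_set n (vanishing_left_ideal n B)"
  using assms polys_0_1(2) [of n] unfolding zero_set_def vanishing_left_ideal_def by fastforce

text \<open>
  The indices $l \<le> \<cdot> < r$ form a block. A relation in it that holds on $B$ gives an
  element of the left ideal, so it passes to all common zeros.
\<close>

lemma zero_set_relation:
  assumes a: "a \<in> zero_set n (vanishing_left_ideal n B)"
    and len: "\<And>b. b \<in> B \<Longrightarrow> length b = n"
    and ij: "l \<le> i" "i < r" "l \<le> j" "j < r" "r \<le> n"
    and block: "\<And>b i j. \<lbrakk>b \<in> B; l \<le> i; i < r; l \<le> j; j < r\<rbrakk> \<Longrightarrow> b ! i * b ! j = b ! j * b ! i"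
    and coeffs: "\<And>b i. b \<in> B \<Longrightarrow> i < r \<Longrightarrow> p * b ! i = b ! i * p \<and> q * b ! i = b ! i * q"
    and rel: "\<And>b. b \<in> B \<Longrightarrow> b ! i ^ e = p * b ! j + q"
  shows "a ! i ^ e = p * a ! j + q"
proof -
  let ?f = "relation_poly i e j p q"
  have f: "Poly_Mapping.keys k \<subseteq> {l..<r}" if "k \<in> Poly_Mapping.keys ?f" for k
    using keys_relation_poly [OF that] ij by auto
  have "eval_poly (g * ?f) b = 0" if b: "b \<in> B" for g b
  proof (rule eval_poly_mult_eq_0)
    show "r \<le> length b"
      using ij len [OF b] by simp
    show "eval_poly ?f b = 0"
      using ij len [OF b] rel [OF b] by (simp add: eval_relation_poly)
    show "Poly_Mapping.lookup ?f k * b ! i = b ! i * Poly_Mapping.lookup ?f k" if "i < r" for k i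
      using coeffs [OF b that] by (simp add: lookup_relation_poly_commutes)
  qed (use f block [OF b] in auto)
  moreover have "?f \<in> polys n"
    using f ij unfolding polys_def by fastforce
  ultimately have "eval_poly ?f a = 0" "length a = n"
    using a by (auto simp: zero_set_def vanishing_left_ideal_def)
  with ij show ?thesis
    by (simp add: eval_relation_poly algebra_simps)
qed

section \<open>Points and their blocks\<close>

lemma concat_nth_block:
  assumes "i < length bs" "j < length (bs ! i)"
  shows "concat bs ! (length (concat (take i bs)) + j) = bs ! i ! j"
proof -
  have "concat bs = concat (take i bs) @ bs ! i @ concat (drop (Suc i) bs)"
    using id_take_nth_drop [OF assms(1)] by (metis concat.simps(2) concat_append)
  then show ?thesis
    using assms(2) by (simp add: nth_append)
qed

lemma block_end_le_length:
  assumes "i < length bs"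
  shows "length (concat (take i bs)) + length (bs ! i) \<le> length (concat bs)"
proof -
  have "concat bs = concat (take i bs) @ bs ! i @ concat (drop (Suc i) bs)"
    using id_take_nth_drop [OF assms] by (metis concat.simps(2) concat_append)
  then show ?thesis by simp
qed

lemma split_into_blocks:
  "length a = sum_list ks \<Longrightarrow> \<exists>as. concat as = a \<and> map length as = ks"
proof (induction ks arbitrary: a)
  case (Cons k ks)
  then have "length (drop k a) = sum_list ks"
    by simp
  then obtain as where "concat as = drop k a" "map length as = ks"
    using Cons.IH by blast
  with Cons.prems show ?case
    by (intro exI [of _ "take k a # as"]) simp
qed simp

text \<open>
  Since $v_0 \<in> S_{v_0}$, the first block can be treated like the others, up to the condition that
  it is equal to $v_0$.
\<close>

lemma multisphere_blocks:
  assumes "v \<noteq> []"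
  shows "multisphere v = {concat bs | bs.
    list_all2 (\<lambda>w u. w \<in> sphere u) bs (central_blocks v) \<and> hd bs = hd (central_blocks v)}"
proof -
  obtain u us where us: "central_blocks v = u # us"
    using central_presentation_hd [OF central_presentation_central_blocks [OF assms]]
    by (cases "central_blocks v") auto
  show ?thesis
    unfolding multisphere_def us
  proof (intro set_eqI iffI; elim CollectE exE conjE; intro CollectI)
    fix b ws
    assume "b = hd (u # us) @ concat ws" "list_all2 (\<lambda>w u. w \<in> sphere u) ws (tl (u # us))"
    then show "\<exists>bs. b = concat bs \<and> list_all2 (\<lambda>w u. w \<in> sphere u) bs (u # us) \<and>
        hd bs = hd (u # us)"
      by (intro exI [of _ "u # ws"]) (simp add: sphere_self)
  next
    fix b bs
    assume "b = concat bs" "list_all2 (\<lambda>w u. w \<in> sphere u) bs (u # us)" "hd bs = hd (u # us)"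
    then show "\<exists>ws. b = hd (u # us) @ concat ws \<and>
        list_all2 (\<lambda>w u. w \<in> sphere u) ws (tl (u # us))"
      by (auto simp: list_all2_Cons2)
  qed
qed

section \<open>Multispheres are zero sets of left ideals\<close>

theorem theorem4p3:
  fixes n :: nat and v :: "quat list"
  assumes "n \<ge> 1" and "length v = n"
  shows "\<exists>J. left_ideal n J \<and> multisphere v = zero_set n J"
proof -
  define vs where "vs = central_blocks v"
  have v: "v \<noteq> []" using assms by auto
  have pres: "central_presentation v vs"
    unfolding vs_def by (rule central_presentation_central_blocks [OF v])
  have vs: "vs \<noteq> []" "concat vs = v" and
    vs_block: "\<And>i. i < length vs \<Longrightarrow> commuting (vs ! i) \<and> vs ! i \<noteq> []"
    using pres by (auto simp: central_presentation_def)
  \<comment> \<open>Block \<open>i\<close> occupies the positions from \<open>l i\<close> up to, but excluding, \<open>r i\<close>.\<close>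
  define l r where "l i = length (concat (take i vs))" and "r i = l i + length (vs ! i)" for i
  have r_le: "r i \<le> n" if "i < length vs" for i
    using block_end_le_length [OF that] vs assms by (simp add: l_def r_def)
  have l0: "l 0 = 0" by (simp add: l_def)
  have nth: "concat bs ! (l i + j) = bs ! i ! j"
    if "map length bs = map length vs" "i < length vs" "j < length (vs ! i)"
    for bs :: "quat list list" and i j
  proof -
    have "length bs = length vs"
      using that(1) by (rule map_eq_imp_length_eq)
    moreover from this have "length (bs ! i) = length (vs ! i)"
      using that by (metis nth_map)
    moreover have "length (concat (take i bs)) = l i"
      unfolding l_def length_concat by (metis that(1) take_map)
    ultimately show ?thesis
      using concat_nth_block [of i bs j] that by simp
  qed
  define B where "B = multisphere v"
  have B: "B = {concat bs | bs. list_all2 (\<lambda>w u. w \<in> sphere u) bs vs \<and> hd bs = hd vs}"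
    unfolding B_def vs_def by (rule multisphere_blocks [OF v])
  have B_blocks: "\<exists>bs. b = concat bs \<and> map length bs = map length vs \<and> hd bs = hd vs \<and>
      (\<forall>i < length vs. bs ! i \<in> sphere (vs ! i))" if "b \<in> B" for b
  proof -
    obtain bs where bs: "b = concat bs" "list_all2 (\<lambda>w u. w \<in> sphere u) bs vs" "hd bs = hd vs"
      using \<open>b \<in> B\<close> B by blast
    then have "map length bs = map length vs"
      by (intro nth_equalityI) (auto simp: list_all2_conv_all_nth sphere_length)
    with bs show ?thesis
      by (auto simp: list_all2_conv_all_nth)
  qed
  have B_length: "length b = n" if b: "b \<in> B" for b
  proof -
    obtain bs where "b = concat bs" "map length bs = map length vs"
      using B_blocks [OF b] by blast
    then have "length b = length (concat vs)"
      by (simp add: length_concat)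
    then show ?thesis
      using vs assms by simp
  qed
  have B_commuting: "b ! i' * b ! j' = b ! j' * b ! i'"
    if b: "b \<in> B" and i: "i < length vs"
      and i': "l i \<le> i'" "i' < r i" and j': "l i \<le> j'" "j' < r i" for b i i' j'
  proof -
    obtain bs where bs: "b = concat bs" "map length bs = map length vs" "bs ! i \<in> sphere (vs ! i)"
      using B_blocks [OF b] i by blast
    have "commuting (bs ! i)" and len: "length (bs ! i) = length (vs ! i)"
      using sphere_commuting [OF bs(3)] sphere_length [OF bs(3)] vs_block i by auto
    moreover have "b ! i' = bs ! i ! (i' - l i)" "b ! j' = bs ! i ! (j' - l i)"
      using nth [OF bs(2) i, of "i' - l i"] nth [OF bs(2) i, of "j' - l i"] i' j'
      by (simp_all add: bs(1) r_def)
    ultimately show ?thesis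
      using i' j' by (simp add: commuting_def r_def)
  qed
  let ?J = "vanishing_left_ideal n B"
  have "zero_set n ?J \<subseteq> B"
  proof
    fix a assume a: "a \<in> zero_set n ?J"
    then have "length a = sum_list (map length vs)"
      using vs assms by (simp add: zero_set_def flip: length_concat)
    then obtain as where as: "concat as = a" "map length as = map length vs"
      using split_into_blocks by blast
    have len: "length as = length vs" "\<And>i. i < length vs \<Longrightarrow> length (as ! i) = length (vs ! i)"
      using as(2) by (metis length_map, metis length_map nth_map)
    \<comment> \<open>Real coefficients commute with everything, so every block inherits the real relations.\<close>
    have "as ! i \<in> sphere (vs ! i)" if i: "i < length vs" for i
    proof (rule in_sphere_if_relations)
      fix e j j' and p q :: real
      assume j: "j < length (vs ! i)" "j' < length (vs ! i)"
        and rel: "vs ! i ! j ^ e = real_quat p * vs ! i ! j' + real_quat q"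
      have "a ! (l i + j) ^ e = real_quat p * a ! (l i + j') + real_quat q"
      proof (rule zero_set_relation [OF a, where l = "l i" and r = "r i"])
        fix b assume "b \<in> B"
        then obtain bs where bs: "b = concat bs" "map length bs = map length vs"
            "bs ! i \<in> sphere (vs ! i)"
          using B_blocks i by blast
        show "b ! (l i + j) ^ e = real_quat p * b ! (l i + j') + real_quat q"
          using sphere_relation [OF bs(3) j rel] nth [OF bs(2) i] j by (simp add: bs(1))
      qed (use B_length B_commuting i j r_le [OF i] in \<open>auto simp: r_def real_quat_central\<close>)
      then show "as ! i ! j ^ e = real_quat p * as ! i ! j' + real_quat q"
        using nth [OF as(2) i] j as(1) by simp
    qed (use vs_block i len in auto)
    moreover have "as ! 0 = vs ! 0"
    proof (rule nth_equalityI)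
      show "length (as ! 0) = length (vs ! 0)"
        using len vs by simp
      fix j assume "j < length (as ! 0)"
      then have j: "j < length (vs ! 0)" "0 < length vs"
        using len vs by simp_all
      have first: "b ! j' = vs ! 0 ! j'" if b: "b \<in> B" and j': "j' < length (vs ! 0)" for b j'
      proof -
        obtain bs where bs: "b = concat bs" "map length bs = map length vs" "hd bs = hd vs"
          using B_blocks [OF b] by blast
        then have "bs ! 0 = vs ! 0"
          using vs by (metis hd_conv_nth list.map_disc_iff)
        then show ?thesis
          using nth [OF bs(2) j(2) j'] by (simp add: bs(1) l0)
      qed
      \<comment> \<open>The constant term is one of the commuting entries of the first block.\<close>
      have "a ! j ^ 1 = 0 * a ! j + vs ! 0 ! j"
        by (rule zero_set_relation [OF a, where l = "l 0" and r = "r 0"])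
          (use B_length B_commuting [where i = 0] j r_le [of 0] first vs_block [of 0] in
            \<open>auto simp: r_def l0 commuting_def\<close>)
      then show "as ! 0 ! j = vs ! 0 ! j"
        using nth [OF as(2) j(2,1)] as(1) by (simp add: l0)
    qed
    then have "hd as = hd vs"
      using len(1) vs(1) by (metis hd_conv_nth length_0_conv)
    ultimately show "a \<in> B"
      unfolding B using as(1) len(1) by (auto simp: list_all2_conv_all_nth)
  qed
  moreover have "B \<subseteq> zero_set n ?J"
    by (rule subset_zero_set_vanishing_left_ideal) (rule B_length)
  ultimately show ?thesis
    using left_ideal_vanishing_left_ideal unfolding B_def by blast
qed

end
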